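(* Let $J:\mathcal{S}\to\mathbb{R}$ be a function such that $J(i)\le (TJ)(i)\le J^*(i)$ for all $i\in\mathcal{S}$, where $T$ is the Bellman operator and $J^*$ is the optimal cost function. Then, for any integer $m$ with $1\le m\le n$, $$(T^kJ)(i)\le (B_m^kJ)(i)\le (F^kJ)(i)\le J^*(i),\qquad i=1,\dots,n,\quad k=1,2,\dots,$$ where $B_m$ is the mini-batch operator with batch-size $m$ and $F$ is the Gauss-Seidel operator.
   Context: A (finite, discounted) Markov decision process is a tuple $(\mathcal{S},\mathcal{U},P,g,\alpha)$ with finite state space $\mathcal{S}=\{1,\dots,n\}$, finite control space $\mathcal{U}$, nonempty subsets $\mathcal{U}(i)\subseteq\mathcal{U}$ of controls associated with each state $i$, transition probabilities $p_{ij}(u)\in[0,1]$ (probability of moving from state $i$ to state $j$ under control $u\in\mathcal{U}(i)$, so $\sum_{j\in\mathcal{S}}p_{ij}(u)=1$), stage cost $g:\mathcal{S}\times\mathcal{U}\to\mathbb{R}$, and discount factor $\alpha\in(0,1)$. Fix such an MDP. A (stationary admissible) policy is a map $\mu:\mathcal{S}\to\mathcal{U}$ with $\mu(i)\in\mathcal{U}(i)$ for all $i$; $\Pi$ is the set of all policies. The cost of $\mu$ is $J_\mu(i_0)=\lim_{N\to\infty}\mathbb{E}_\mu\left[\sum_{t=0}^{N-1}\alpha^t g(i_t,\mu(i_t))\right]$, the expectation being over the state sequence generated from $i_0$ under $\mu$. The optimal cost function is $J^*(i)=\min_{\mu\in\Pi}J_\mu(i)$, $i\in\mathcal{S}$.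 Bellman operator: for $J:\mathcal{S}\to\mathbb{R}$, $(TJ)(i)=\min_{u\in\mathcal{U}(i)}\left[g(i,u)+\alpha\sum_{j\in\mathcal{S}}p_{ij}(u)J(j)\right]$, $i\in\mathcal{S}$. Gauss-Seidel operator: for $J:\mathcal{S}\to\mathbb{R}$, $FJ$ is defined recursively in increasing $i=1,\dots,n$ by $$(FJ)(i)=\min_{u\in\mathcal{U}(i)}\left[g(i,u)+\alpha\sum_{j=1}^{i-1}p_{ij}(u)(FJ)(j)+\alpha\sum_{j=i}^{n}p_{ij}(u)J(j)\right].$$ Mini-batch operator: for an integer batch-size $1\le m\le n$, let $\mathcal{M}_m(i)=\{j\in\mathbb{N}: 1\le j\le m\lfloor (i-1)/m\rfloor\}$ (empty if $\lfloor (i-1)/m\rfloor=0$), so $\mathcal{M}_m(i)\subseteq\{1,\dots,i-1\}$. For $J:\mathcal{S}\to\mathbb{R}$, the function $B_mJ:\mathcal{S}\to\mathbb{R}$ is defined recursively in increasing $i$ by $$(B_mJ)(i)=\min_{u\in\mathcal{U}(i)}\left[g(i,u)+\alpha\sum_{j\in\mathcal{S}\setminus\mathcal{M}_m(i)}p_{ij}(u)J(j)+\alpha\sum_{j\in\mathcal{M}_m(i)}p_{ij}(u)(B_mJ)(j)\right].$$ A superscript $k$ on an operator denotes its $k$-fold composition with itself. *)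

theory Defs
  imports "HOL-Probability.Probability_Mass_Function"
begin

text \<open>
  The states are the naturals \<open>1, \<dots>, n\<close>, \<open>adm i\<close> is the set \<open>U(i)\<close> of controls admissible in
  state \<open>i\<close>, and \<open>p i j u\<close> is the probability of moving from \<open>i\<close> to \<open>j\<close> under \<open>u\<close>.
  Functions on the state space are of type \<open>nat \<Rightarrow> real\<close>; at arguments in \<open>{1..n}\<close>, none of the
  notions below depends on the values of their arguments outside \<open>{1..n}\<close>.
\<close>

locale finite_mdp =
  fixes n :: nat
    and controls :: "'u set"
    and adm :: "nat \<Rightarrow> 'u set"
    and p :: "nat \<Rightarrow> nat \<Rightarrow> 'u \<Rightarrow> real"
    and g :: "nat \<Rightarrow> 'u \<Rightarrow> real"
    and \<alpha> :: real
  assumes finite_controls: "finite controls"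
    and adm_nonempty: "i \<in> {1..n} \<Longrightarrow> adm i \<noteq> {}"
    and adm_subset: "i \<in> {1..n} \<Longrightarrow> adm i \<subseteq> controls"
    and p_range: "\<lbrakk>i \<in> {1..n}; j \<in> {1..n}; u \<in> adm i\<rbrakk> \<Longrightarrow> p i j u \<in> {0..1}"
    and p_sum: "\<lbrakk>i \<in> {1..n}; u \<in> adm i\<rbrakk> \<Longrightarrow> (\<Sum>j\<in>{1..n}. p i j u) = 1"
    and discount: "\<alpha> \<in> {0<..<1}"
begin

definition policies :: "(nat \<Rightarrow> 'u) set" where
  "policies = (\<Pi>\<^sub>E i\<in>{1..n}. adm i)"

definition next_state :: "nat \<Rightarrow> 'u \<Rightarrow> nat pmf" where
  "next_state i u = embed_pmf (\<lambda>j. if j \<in> {1..n} then p i j u else 0)"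

lemma pmf_next_state:
  assumes "i \<in> {1..n}" "u \<in> adm i"
  shows "pmf (next_state i u) j = (if j \<in> {1..n} then p i j u else 0)"
  unfolding next_state_def
proof (rule pmf_embed_pmf)
  have nonneg: "0 \<le> p i j u" if "j \<in> {1..n}" for j
    using p_range[OF assms(1) that assms(2)] by simp
  then show "0 \<le> (if j \<in> {1..n} then p i j u else 0)" for j
    by simp
  have "(\<integral>\<^sup>+j. ennreal (if j \<in> {1..n} then p i j u else 0) \<partial>count_space UNIV)
      = (\<Sum>j\<in>{1..n}. ennreal (if j \<in> {1..n} then p i j u else 0))"
    by (rule nn_integral_count_space') auto
  also have "\<dots> = (\<Sum>j\<in>{1..n}. ennreal (p i j u))"
    by (rule sum.cong) auto
  also have "\<dots> = ennreal (\<Sum>j\<in>{1..n}. p i j u)"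
    using nonneg by (intro sum_ennreal) auto
  finally show "(\<integral>\<^sup>+j. ennreal (if j \<in> {1..n} then p i j u else 0) \<partial>count_space UNIV) = 1"
    using p_sum[OF assms] by simp
qed

text \<open>
  Joint law of the first \<open>N\<close> states \<open>[i\<^sub>0, \<dots>, i\<^sub>N\<^sub>-\<^sub>1]\<close> of the Markov chain started in \<open>i\<close>
  and controlled by \<open>\<mu>\<close>.
\<close>

primrec trajectory :: "(nat \<Rightarrow> 'u) \<Rightarrow> nat \<Rightarrow> nat \<Rightarrow> nat list pmf" where
  "trajectory \<mu> 0 i = return_pmf []"
| "trajectory \<mu> (Suc N) i =
     bind_pmf (next_state i (\<mu> i)) (\<lambda>j. map_pmf ((#) i) (trajectory \<mu> N j))"

definition policy_cost :: "(nat \<Rightarrow> 'u) \<Rightarrow> nat \<Rightarrow> real" where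
  "policy_cost \<mu> i = lim (\<lambda>N. measure_pmf.expectation (trajectory \<mu> N i)
     (\<lambda>s. \<Sum>t<N. \<alpha> ^ t * g (s ! t) (\<mu> (s ! t))))"

definition optimal_cost :: "nat \<Rightarrow> real" where
  "optimal_cost i = Min ((\<lambda>\<mu>. policy_cost \<mu> i) ` policies)"

definition bellman :: "(nat \<Rightarrow> real) \<Rightarrow> nat \<Rightarrow> real" where
  "bellman J i = Min ((\<lambda>u. g i u + \<alpha> * (\<Sum>j\<in>{1..n}. p i j u * J j)) ` adm i)"

function gauss_seidel :: "(nat \<Rightarrow> real) \<Rightarrow> nat \<Rightarrow> real" where
  "gauss_seidel J i = Min ((\<lambda>u. g i u
       + \<alpha> * (\<Sum>j\<in>{1..<i}. p i j u * gauss_seidel J j)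
       + \<alpha> * (\<Sum>j\<in>{i..n}. p i j u * J j)) ` adm i)"
  by pat_completeness auto
termination by (relation "Wellfounded.measure snd") auto

declare gauss_seidel.simps [simp del]

definition batch :: "nat \<Rightarrow> nat \<Rightarrow> nat set" where
  "batch m i = {j. 1 \<le> j \<and> j \<le> m * ((i - 1) div m)}"

lemma batch_less: "j \<in> batch m i \<Longrightarrow> j < i"
proof -
  assume "j \<in> batch m i"
  then have "1 \<le> j" "j \<le> m * ((i - 1) div m)"
    by (simp_all add: batch_def)
  moreover have "m * ((i - 1) div m) \<le> i - 1"
    by (rule times_div_less_eq_dividend)
  ultimately show "j < i"
    by linarith
qed

function mini_batch :: "nat \<Rightarrow> (nat \<Rightarrow> real) \<Rightarrow> nat \<Rightarrow> real" where
  "mini_batch m J i = Min ((\<lambda>u. g i u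
       + \<alpha> * (\<Sum>j\<in>{1..n} - batch m i. p i j u * J j)
       + \<alpha> * (\<Sum>j\<in>batch m i. p i j u * mini_batch m J j)) ` adm i)"
  by pat_completeness auto
termination by (relation "Wellfounded.measure (\<lambda>(m, J, i). i)") (auto dest: batch_less)

declare mini_batch.simps [simp del]

end

end

theory Submission
  imports Defs
begin

text \<open>
  All three operators have one shape: the new value at \<open>i\<close> is the Bellman update of a function
  that takes the freshly computed values on a set \<open>S i\<close> of smaller states and the old values
  elsewhere. For \<open>T\<close>, \<open>B\<^sub>m\<close> and \<open>F\<close> these sets are empty, \<open>batch m i\<close> and \<open>{1..<i}\<close>, so they
  increase. Call a function \<open>J\<close> a subsolution if \<open>J \<le> T J\<close>. By monotonicity of \<open>T\<close> and induction on
  the state, a sweep never lowers a subsolution (\<open>sweep_increasing\<close>); hence fresh values are better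
  lower bounds than old ones, and using more of them gives a larger result (\<open>sweep_mono\<close>). The
  result is again a subsolution (\<open>sweep_subsolution\<close>), because replacing the remaining old values by
  fresh ones can only raise the Bellman update. So both facts iterate, which gives the first two
  inequalities.

  The last inequality holds because every subsolution lies below \<open>J\<^sup>*\<close>
  (\<open>subsolution_le_optimal_cost\<close>). For a policy \<open>\<mu>\<close>, a subsolution \<open>K\<close> satisfies
  \<open>K \<le> g\<^sub>\<mu> + \<alpha> P\<^sub>\<mu> K\<close>; unrolling this \<open>N\<close> times bounds \<open>K\<close> by the \<open>N\<close>-stage cost of \<open>\<mu>\<close>
  plus a term of order \<open>\<alpha>\<^sup>N\<close>, and \<open>N \<rightarrow> \<infinity>\<close> gives \<open>K \<le> J\<^sub>\<mu>\<close>. The limit defining \<open>J\<^sub>\<mu>\<close> exists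
  because the discounted expected stage costs form an absolutely convergent series.
\<close>

context finite_mdp
begin

section \<open>Sweeps of Bellman updates\<close>

lemma finite_adm: "i \<in> {1..n} \<Longrightarrow> finite (adm i)"
  using adm_subset finite_controls by (rule finite_subset)

lemma bellman_le:
  assumes "i \<in> {1..n}" "u \<in> adm i"
  shows "bellman K i \<le> g i u + \<alpha> * (\<Sum>j\<in>{1..n}. p i j u * K j)"
  unfolding bellman_def using assms finite_adm by (intro Min_le) auto

lemma bellman_mono:
  assumes "\<forall>j\<in>{1..n}. K j \<le> L j" and i: "i \<in> {1..n}"
  shows "bellman K i \<le> bellman L i"
proof -
  have "bellman K i \<le> g i u + \<alpha> * (\<Sum>j\<in>{1..n}. p i j u * L j)" if u: "u \<in> adm i" for u
  proof -
    have "(\<Sum>j\<in>{1..n}. p i j u * K j) \<le> (\<Sum>j\<in>{1..n}. p i j u * L j)"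
      using assms p_range[OF i _ u] by (intro sum_mono mult_left_mono) auto
    then have "\<alpha> * (\<Sum>j\<in>{1..n}. p i j u * K j) \<le> \<alpha> * (\<Sum>j\<in>{1..n}. p i j u * L j)"
      using discount by (intro mult_left_mono) auto
    then show ?thesis
      using bellman_le[OF i u, of K] by linarith
  qed
  then show ?thesis
    unfolding bellman_def[of L] using finite_adm[OF i] adm_nonempty[OF i] by simp
qed

text \<open>
  The defining recursion of a sweep is kept as a relation between the old values \<open>J\<close> and the new
  values \<open>H\<close>, so that the three operators can be treated as instances. When \<open>S i \<subseteq> {..<i}\<close>, the
  relation determines \<open>H\<close> on the state space.
\<close>

definition sweep :: "(nat \<Rightarrow> nat set) \<Rightarrow> (nat \<Rightarrow> real) \<Rightarrow> (nat \<Rightarrow> real) \<Rightarrow> bool" where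
  "sweep S J H \<longleftrightarrow> (\<forall>i\<in>{1..n}. H i = bellman (\<lambda>j. if j \<in> S i then H j else J j) i)"

definition subsolution :: "(nat \<Rightarrow> real) \<Rightarrow> bool" where
  "subsolution J \<longleftrightarrow> (\<forall>i\<in>{1..n}. J i \<le> bellman J i)"

lemma sweep_bellman: "sweep (\<lambda>i. {}) J (bellman J)"
  by (simp add: sweep_def)

lemma sweep_gauss_seidel: "sweep (\<lambda>i. {1..<i}) J (gauss_seidel J)"
  unfolding sweep_def
proof
  fix i assume i: "i \<in> {1..n}"
  have "(\<Sum>j\<in>{1..n}. p i j u * (if j \<in> {1..<i} then gauss_seidel J j else J j))
      = (\<Sum>j\<in>{1..<i}. p i j u * gauss_seidel J j) + (\<Sum>j\<in>{i..n}. p i j u * J j)" for u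
  proof -
    have "{1..n} = {1..<i} \<union> {i..n}" using i by auto
    then show ?thesis
      by (simp add: sum.union_disjoint ivl_disj_int)
  qed
  then show "gauss_seidel J i = bellman (\<lambda>j. if j \<in> {1..<i} then gauss_seidel J j else J j) i"
    by (subst gauss_seidel.simps) (simp add: bellman_def distrib_left add.assoc)
qed

lemma sweep_mini_batch: "sweep (batch m) J (mini_batch m J)"
  unfolding sweep_def
proof
  fix i assume i: "i \<in> {1..n}"
  have sub: "batch m i \<subseteq> {1..n}"
  proof
    fix j assume j: "j \<in> batch m i"
    then show "j \<in> {1..n}"
      using batch_less[OF j] i by (auto simp: batch_def)
  qed
  have "(\<Sum>j\<in>{1..n}. p i j u * (if j \<in> batch m i then mini_batch m J j else J j))
      = (\<Sum>j\<in>{1..n} - batch m i. p i j u * J j) + (\<Sum>j\<in>batch m i. p i j u * mini_batch m J j)"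
    for u
    by (subst sum.subset_diff[OF sub]) simp_all
  then show "mini_batch m J i = bellman (\<lambda>j. if j \<in> batch m i then mini_batch m J j else J j) i"
    by (subst mini_batch.simps) (simp add: bellman_def distrib_left add.assoc)
qed

text \<open>
  The values already computed in the sweep are at least the old ones by induction, so the update at
  \<open>i\<close> is at least \<open>T J i \<ge> J i\<close>.
\<close>

lemma sweep_increasing:
  assumes "sweep S J H" "subsolution J" and S: "\<And>i. S i \<subseteq> {..<i}"
  shows "i \<in> {1..n} \<Longrightarrow> J i \<le> H i"
proof (induction i rule: less_induct)
  case (less i)
  have "J i \<le> bellman J i"
    using assms(2) less.prems by (simp add: subsolution_def)
  also have "\<dots> \<le> bellman (\<lambda>j. if j \<in> S i then H j else J j) i"
    using less.IH less.prems S by (intro bellman_mono) (simp_all add: subset_iff)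
  also have "\<dots> = H i"
    using assms(1) less.prems by (simp add: sweep_def)
  finally show ?case .
qed

lemma sweep_subsolution:
  assumes "sweep S J H" "subsolution J" "\<And>i. S i \<subseteq> {..<i}"
  shows "subsolution H"
  unfolding subsolution_def
proof
  fix i assume i: "i \<in> {1..n}"
  have "H i = bellman (\<lambda>j. if j \<in> S i then H j else J j) i"
    using assms(1) i by (simp add: sweep_def)
  also have "\<dots> \<le> bellman H i"
    using sweep_increasing[OF assms] i by (intro bellman_mono) auto
  finally show "H i \<le> bellman H i" .
qed

text \<open>
  At a state in \<open>S' i - S i\<close> the first sweep reads the old value \<open>J j\<close> and the second one the new
  value \<open>H' j\<close>; these are compared through \<open>J j \<le> H j \<le> H' j\<close>, which is where \<open>J\<close> has to be a
  subsolution.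
\<close>

lemma sweep_mono:
  assumes "sweep S J H" "sweep S' J' H'" "subsolution J"
    and le: "\<forall>i\<in>{1..n}. J i \<le> J' i"
    and sub: "\<And>i. S i \<subseteq> S' i" and S': "\<And>i. S' i \<subseteq> {..<i}"
  shows "i \<in> {1..n} \<Longrightarrow> H i \<le> H' i"
proof (induction i rule: less_induct)
  case (less i)
  have inc: "J j \<le> H j" if "j \<in> {1..n}" for j
    using sweep_increasing[OF assms(1,3) _ that] sub S' by blast
  have "(if j \<in> S i then H j else J j) \<le> (if j \<in> S' i then H' j else J' j)"
    if j: "j \<in> {1..n}" for j
  proof (cases "j \<in> S' i")
    case True
    then have "H j \<le> H' j"
      using less.IH[of j] S' j by auto
    then show ?thesis
      using True inc[OF j] by auto
  next
    case False
    then show ?thesis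
      using sub[of i] le j by auto
  qed
  then have "bellman (\<lambda>j. if j \<in> S i then H j else J j) i
      \<le> bellman (\<lambda>j. if j \<in> S' i then H' j else J' j) i"
    using less.prems by (intro bellman_mono) auto
  then show ?case
    using assms(1,2) less.prems by (simp add: sweep_def)
qed

lemma subsolution_iterate:
  assumes "\<And>K. sweep S K (A K)" "\<And>i. S i \<subseteq> {..<i}" "subsolution J"
  shows "subsolution ((A ^^ k) J)"
  using assms by (induction k) (auto intro: sweep_subsolution)

lemma sweep_iterate_mono:
  assumes "\<And>K. sweep S K (A K)" "\<And>K. sweep S' K (A' K)" "subsolution J"
    and "\<And>i. S i \<subseteq> S' i" "\<And>i. S' i \<subseteq> {..<i}"
  shows "\<forall>i\<in>{1..n}. (A ^^ k) J i \<le> (A' ^^ k) J i"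
proof (induction k)
  case 0
  show ?case by simp
next
  case (Suc k)
  have "subsolution ((A ^^ k) J)"
    using subsolution_iterate[OF assms(1) _ assms(3)] assms(4,5) by blast
  then show ?case
    using sweep_mono[OF assms(1) assms(2) _ Suc assms(4) assms(5)] by simp
qed


section \<open>Cost of a policy\<close>

definition horizon_cost :: "(nat \<Rightarrow> 'u) \<Rightarrow> nat \<Rightarrow> nat \<Rightarrow> real" where
  "horizon_cost \<mu> N i = measure_pmf.expectation (trajectory \<mu> N i)
     (\<lambda>s. \<Sum>t<N. \<alpha> ^ t * g (s ! t) (\<mu> (s ! t)))"

text \<open>
  The expected stage cost at time \<open>t\<close>, i.e. \<open>P\<^sub>\<mu>\<^sup>t g\<^sub>\<mu>\<close>.
\<close>

primrec stage_cost :: "(nat \<Rightarrow> 'u) \<Rightarrow> nat \<Rightarrow> nat \<Rightarrow> real" where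
  "stage_cost \<mu> 0 i = g i (\<mu> i)"
| "stage_cost \<mu> (Suc t) i = (\<Sum>j\<in>{1..n}. p i j (\<mu> i) * stage_cost \<mu> t j)"

lemma policy_admissible: "\<mu> \<in> policies \<Longrightarrow> i \<in> {1..n} \<Longrightarrow> \<mu> i \<in> adm i"
  by (auto simp: policies_def)

lemma set_pmf_next_state:
  assumes "i \<in> {1..n}" "u \<in> adm i"
  shows "set_pmf (next_state i u) \<subseteq> {1..n}"
  using pmf_next_state[OF assms] by (auto simp: set_pmf_iff split: if_splits)

lemma finite_set_pmf_trajectory:
  assumes "\<mu> \<in> policies"
  shows "i \<in> {1..n} \<Longrightarrow> finite (set_pmf (trajectory \<mu> N i))"
proof (induction N arbitrary: i)
  case (Suc N)
  have sub: "set_pmf (next_state i (\<mu> i)) \<subseteq> {1..n}"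
    using Suc.prems assms by (intro set_pmf_next_state policy_admissible)
  then have "finite (set_pmf (next_state i (\<mu> i)))"
    by (rule finite_subset) simp
  moreover have "finite (set_pmf (trajectory \<mu> N j))" if "j \<in> set_pmf (next_state i (\<mu> i))" for j
    using Suc.IH sub that by blast
  ultimately show ?case
    by simp
qed simp

text \<open>
  Conditioning on the first transition.
\<close>

lemma horizon_cost_Suc:
  assumes \<mu>: "\<mu> \<in> policies" and i: "i \<in> {1..n}"
  shows "horizon_cost \<mu> (Suc N) i
    = g i (\<mu> i) + \<alpha> * (\<Sum>j\<in>{1..n}. p i j (\<mu> i) * horizon_cost \<mu> N j)"
proof -
  let ?G = "\<lambda>N s. \<Sum>t<N. \<alpha> ^ t * g (s ! t) (\<mu> (s ! t))"
  let ?f = "\<lambda>j. map_pmf ((#) i) (trajectory \<mu> N j)"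
  have adm: "\<mu> i \<in> adm i"
    using \<mu> i by (rule policy_admissible)
  have shift: "?G (Suc N) (i # s) = g i (\<mu> i) + \<alpha> * ?G N s" for s
    by (subst sum.lessThan_Suc_shift) (simp add: sum_distrib_left mult.assoc)
  have cont: "measure_pmf.expectation (?f j) (?G (Suc N)) = g i (\<mu> i) + \<alpha> * horizon_cost \<mu> N j"
    if "j \<in> {1..n}" for j
  proof -
    have "integrable (measure_pmf (trajectory \<mu> N j)) (?G N)"
      using finite_set_pmf_trajectory[OF \<mu> that] by (rule integrable_measure_pmf_finite)
    then show ?thesis
      unfolding integral_map_pmf shift horizon_cost_def by simp
  qed
  have "horizon_cost \<mu> (Suc N) i = (\<Sum>j\<in>{1..n}. pmf (next_state i (\<mu> i)) j *\<^sub>R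
      measure_pmf.expectation (?f j) (?G (Suc N)))"
    unfolding horizon_cost_def trajectory.simps
    using finite_set_pmf_trajectory[OF \<mu>] set_pmf_next_state[OF i adm]
    by (intro pmf_expectation_bind) auto
  also have "\<dots> = (\<Sum>j\<in>{1..n}. p i j (\<mu> i) * (g i (\<mu> i) + \<alpha> * horizon_cost \<mu> N j))"
    by (intro sum.cong) (simp_all only: cont pmf_next_state[OF i adm], simp_all)
  also have "\<dots> = (\<Sum>j\<in>{1..n}. p i j (\<mu> i)) * g i (\<mu> i)
      + \<alpha> * (\<Sum>j\<in>{1..n}. p i j (\<mu> i) * horizon_cost \<mu> N j)"
    by (simp add: sum.distrib sum_distrib_left sum_distrib_right algebra_simps)
  finally show ?thesis
    using p_sum[OF i adm] by simp
qed

lemma horizon_cost_eq_sum: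
  assumes "\<mu> \<in> policies"
  shows "i \<in> {1..n} \<Longrightarrow> horizon_cost \<mu> N i = (\<Sum>t<N. \<alpha> ^ t * stage_cost \<mu> t i)"
proof (induction N arbitrary: i)
  case 0
  show ?case by (simp add: horizon_cost_def)
next
  case (Suc N)
  have "(\<Sum>j\<in>{1..n}. p i j (\<mu> i) * horizon_cost \<mu> N j)
      = (\<Sum>j\<in>{1..n}. \<Sum>t<N. \<alpha> ^ t * (p i j (\<mu> i) * stage_cost \<mu> t j))"
    using Suc.IH by (intro sum.cong) (simp_all add: sum_distrib_left algebra_simps)
  also have "\<dots> = (\<Sum>t<N. \<alpha> ^ t * stage_cost \<mu> (Suc t) i)"
    by (subst sum.swap) (simp add: sum_distrib_left)
  finally have "horizon_cost \<mu> (Suc N) i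
      = g i (\<mu> i) + \<alpha> * (\<Sum>t<N. \<alpha> ^ t * stage_cost \<mu> (Suc t) i)"
    using horizon_cost_Suc[OF assms Suc.prems] by simp
  also have "\<dots> = (\<Sum>t<Suc N. \<alpha> ^ t * stage_cost \<mu> t i)"
    by (subst sum.lessThan_Suc_shift) (simp add: sum_distrib_left mult.assoc)
  finally show ?case .
qed

lemma expectation_abs_le:
  assumes "i \<in> {1..n}" "u \<in> adm i" and K: "\<forall>j\<in>{1..n}. \<bar>K j\<bar> \<le> C"
  shows "\<bar>\<Sum>j\<in>{1..n}. p i j u * K j\<bar> \<le> C"
proof -
  have "\<bar>\<Sum>j\<in>{1..n}. p i j u * K j\<bar> \<le> (\<Sum>j\<in>{1..n}. p i j u * C)"
    using p_range[OF assms(1) _ assms(2)] K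
    by (intro order_trans[OF sum_abs] sum_mono) (auto simp: abs_mult intro!: mult_left_mono)
  also have "\<dots> = C"
    using p_sum[OF assms(1,2)] by (simp flip: sum_distrib_right)
  finally show ?thesis .
qed

lemma bounded_on_states: "\<exists>C. \<forall>j\<in>{1..n}. \<bar>K j :: real\<bar> \<le> C"
  by (rule exI[of _ "\<Sum>j\<in>{1..n}. \<bar>K j\<bar>"]) (auto intro!: member_le_sum)

lemma horizon_cost_tendsto:
  assumes \<mu>: "\<mu> \<in> policies" and i: "i \<in> {1..n}"
  shows "(\<lambda>N. horizon_cost \<mu> N i) \<longlonglongrightarrow> policy_cost \<mu> i"
proof -
  obtain C where C: "\<forall>j\<in>{1..n}. \<bar>g j (\<mu> j)\<bar> \<le> C"
    using bounded_on_states[of "\<lambda>j. g j (\<mu> j)"] by blast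
  have bound: "\<forall>j\<in>{1..n}. \<bar>stage_cost \<mu> t j\<bar> \<le> C" for t
    by (induction t) (use C expectation_abs_le policy_admissible[OF \<mu>] in auto)
  have "summable (\<lambda>t. \<alpha> ^ t * stage_cost \<mu> t i)"
  proof (rule summable_comparison_test')
    show "summable (\<lambda>t. \<alpha> ^ t * C)"
      using discount by (intro summable_mult2 summable_geometric) auto
    show "norm (\<alpha> ^ t * stage_cost \<mu> t i) \<le> \<alpha> ^ t * C" for t
      using bound i discount by (auto simp: abs_mult intro!: mult_left_mono)
  qed
  then have "convergent (\<lambda>N. horizon_cost \<mu> N i)"
    unfolding horizon_cost_eq_sum[OF \<mu> i] by (simp add: summable_iff_convergent)
  then show ?thesis
    by (simp add: convergent_LIMSEQ_iff policy_cost_def horizon_cost_def)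
qed

text \<open>
  Following \<open>\<mu>\<close> for \<open>N\<close> stages and then paying \<open>K \<le> C\<close> costs at most the right-hand side, and a
  subsolution never exceeds such a cost, since each Bellman update minimises over a choice that
  includes \<open>\<mu> i\<close>.
\<close>

lemma subsolution_le_horizon_cost:
  assumes K: "subsolution K" and \<mu>: "\<mu> \<in> policies" and C: "\<forall>j\<in>{1..n}. K j \<le> C"
  shows "i \<in> {1..n} \<Longrightarrow> K i \<le> horizon_cost \<mu> N i + \<alpha> ^ N * C"
proof (induction N arbitrary: i)
  case 0
  then show ?case using C by (simp add: horizon_cost_def)
next
  case (Suc N)
  have adm: "\<mu> i \<in> adm i"
    using \<mu> Suc.prems by (rule policy_admissible)
  have "(\<Sum>j\<in>{1..n}. p i j (\<mu> i) * K j)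
      \<le> (\<Sum>j\<in>{1..n}. p i j (\<mu> i) * (horizon_cost \<mu> N j + \<alpha> ^ N * C))"
    using Suc.IH p_range[OF Suc.prems _ adm] by (intro sum_mono mult_left_mono) auto
  also have "\<dots> = (\<Sum>j\<in>{1..n}. p i j (\<mu> i) * horizon_cost \<mu> N j)
      + (\<Sum>j\<in>{1..n}. p i j (\<mu> i)) * (\<alpha> ^ N * C)"
    by (simp add: distrib_left sum.distrib sum_distrib_right)
  also have "\<dots> = (\<Sum>j\<in>{1..n}. p i j (\<mu> i) * horizon_cost \<mu> N j) + \<alpha> ^ N * C"
    using p_sum[OF Suc.prems adm] by simp
  finally have "\<alpha> * (\<Sum>j\<in>{1..n}. p i j (\<mu> i) * K j)
      \<le> \<alpha> * ((\<Sum>j\<in>{1..n}. p i j (\<mu> i) * horizon_cost \<mu> N j) + \<alpha> ^ N * C)"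
    using discount by (intro mult_left_mono) auto
  moreover have "K i \<le> g i (\<mu> i) + \<alpha> * (\<Sum>j\<in>{1..n}. p i j (\<mu> i) * K j)"
    using K Suc.prems bellman_le[OF Suc.prems adm, of K] by (force simp: subsolution_def)
  ultimately show ?case
    using horizon_cost_Suc[OF \<mu> Suc.prems, of N] by (simp add: distrib_left mult.assoc)
qed

lemma subsolution_le_optimal_cost:
  assumes K: "subsolution K" and i: "i \<in> {1..n}"
  shows "K i \<le> optimal_cost i"
proof -
  obtain C where "\<forall>j\<in>{1..n}. \<bar>K j\<bar> \<le> C"
    using bounded_on_states by blast
  then have C: "\<forall>j\<in>{1..n}. K j \<le> C"
    by (auto dest: abs_le_D1)
  have "K i \<le> policy_cost \<mu> i" if \<mu>: "\<mu> \<in> policies" for \<mu>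
  proof (rule LIMSEQ_le_const)
    have "(\<lambda>N. \<alpha> ^ N * C) \<longlonglongrightarrow> 0"
      using discount by (intro tendsto_mult_left_zero LIMSEQ_realpow_zero) auto
    then show "(\<lambda>N. horizon_cost \<mu> N i + \<alpha> ^ N * C) \<longlonglongrightarrow> policy_cost \<mu> i"
      using tendsto_add[OF horizon_cost_tendsto[OF \<mu> i]] by force
    show "\<exists>N. \<forall>k\<ge>N. K i \<le> horizon_cost \<mu> k i + \<alpha> ^ k * C"
      using subsolution_le_horizon_cost[OF K \<mu> C i] by blast
  qed
  moreover have "finite policies" "policies \<noteq> {}"
    unfolding policies_def using finite_adm adm_nonempty
    by (auto intro!: finite_PiE simp: PiE_eq_empty_iff)
  ultimately show ?thesis
    by (simp add: optimal_cost_def)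
qed

end


section \<open>Comparison of the iterations\<close>

theorem mainTheorem2:
  fixes n :: nat
    and controls :: "'u set"
    and adm :: "nat \<Rightarrow> 'u set"
    and p :: "nat \<Rightarrow> nat \<Rightarrow> 'u \<Rightarrow> real"
    and g :: "nat \<Rightarrow> 'u \<Rightarrow> real"
    and \<alpha> :: real
    and J :: "nat \<Rightarrow> real"
    and m :: nat
  assumes "finite_mdp n controls adm p \<alpha>"
    and "\<forall>i\<in>{1..n}. J i \<le> finite_mdp.bellman n adm p g \<alpha> J i \<and>
      finite_mdp.bellman n adm p g \<alpha> J i \<le> finite_mdp.optimal_cost n adm p g \<alpha> i"
    and "1 \<le> m" and "m \<le> n"
  shows "\<forall>i\<in>{1..n}. \<forall>k\<ge>1.
    (finite_mdp.bellman n adm p g \<alpha> ^^ k) J i \<le> (finite_mdp.mini_batch n adm p g \<alpha> m ^^ k) J i \<and>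
    (finite_mdp.mini_batch n adm p g \<alpha> m ^^ k) J i \<le> (finite_mdp.gauss_seidel n adm p g \<alpha> ^^ k) J i \<and>
    (finite_mdp.gauss_seidel n adm p g \<alpha> ^^ k) J i \<le> finite_mdp.optimal_cost n adm p g \<alpha> i"

proof -
  interpret finite_mdp n controls adm p g \<alpha>
    by (rule assms(1))
  have J: "subsolution J"
    using assms(2) by (simp add: subsolution_def)
  have batch: "batch m i \<subseteq> {1..<i}" for i
    using batch_less by (auto simp: batch_def)
  have below: "{1..<i} \<subseteq> {..<i}" for i :: nat
    by auto
  have "\<forall>i\<in>{1..n}. (bellman ^^ k) J i \<le> (mini_batch m ^^ k) J i" for k
    by (rule sweep_iterate_mono[OF sweep_bellman sweep_mini_batch J empty_subsetI
          subset_trans[OF batch below]])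
  moreover have "\<forall>i\<in>{1..n}. (mini_batch m ^^ k) J i \<le> (gauss_seidel ^^ k) J i" for k
    by (rule sweep_iterate_mono[OF sweep_mini_batch sweep_gauss_seidel J batch below])
  moreover have "(gauss_seidel ^^ k) J i \<le> optimal_cost i" if "i \<in> {1..n}" for i k
    by (rule subsolution_le_optimal_cost[OF subsolution_iterate[OF sweep_gauss_seidel below J] that])
  ultimately show ?thesis
    by simp
qed

end
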